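(* Let $X$ be a Polish metric space and let $\mathscr{F}$ be any scale. The following properties hold: \begin{itemize} \item (monotonicity) if $A\subset B\subset X$, then $\mathrm{crit}_{\mathscr F}A\leqslant\mathrm{crit}_{\mathscr F}B$; \item (countable union) for any countable family of sets $A_i\subset X$, $\mathrm{crit}_{\mathscr F}\big(\bigcup_iA_i\big)=\sup_i\mathrm{crit}_{\mathscr F}A_i$; \item (Lipschitz monotonicity) if there is a sub-Lipschitz map from $X$ to another Polish metric space $Y$, then $\mathrm{crit}_{\mathscr F}X\leqslant\mathrm{crit}_{\mathscr F}Y$; \item (Lipschitz invariance) if there is a bi-Lipschitz map from $X$ onto another Polish metric space $Y$, then $\mathrm{crit}_{\mathscr F}X=\mathrm{crit}_{\mathscr F}Y$. \end{itemize}
   Context: A scale is a family $\mathscr{F}=(f_s)_{s\in J}$ of continuous non-decreasing functions $f_s:[0,T_s)\to[0,+\infty)$ with $f_s(0)=0$, where $s$ runs over an interval $J\subset\mathbb R$, satisfying the separation property: for all $t>s$ in $J$ and all $C\ge1$, $f_t(Cr)=o(f_s(r))$ as $r\to0$. For $f:[0,T)\to[0,+\infty)$ continuous non-decreasing with $f(0)=0$ and $A\subset X$, let $\Lambda_f(A)=\lim_{\delta\to0}\inf\big\{\sum_{i=1}^\infty f(\operatorname{diam}E_i): A\subset\bigcup_iE_i,\ \operatorname{diam}E_i\le\delta,\ E_i\text{ closed}\big\}$. The critical parameter of $A$ is $\mathrm{crit}_{\mathscr F}A=\sup\{s\in J:\Lambda_{f_s}(A)=+\infty\}=\sup\{s\in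 J:\Lambda_{f_s}(A)>0\}=\inf\{s\in J:\Lambda_{f_s}(A)=0\}=\inf\{s\in J:\Lambda_{f_s}(A)<+\infty\}$, an element of the closure of $J$ in $[-\infty,+\infty]$ (with $\sup\emptyset=\inf J$, $\inf\emptyset=\sup J$). A map $g:X\to Y$ is sub-Lipschitz if there is $D>0$ with $d(g(x),g(x'))\ge D\,d(x,x')$ for all $x,x'\in X$; it is bi-Lipschitz if it is Lipschitz and sub-Lipschitz. *)

theory Defs
  imports "HOL-Analysis.Analysis" "HOL-Library.Landau_Symbols"
begin

text \<open>
  A Polish metric space is a subset \<open>X\<close> of an arbitrary metric space type, with the induced
  metric; this includes the empty space.
\<close>

definition polish_metric_space :: "'a::metric_space set \<Rightarrow> bool" where
  "polish_metric_space X \<longleftrightarrow> complete X \<and> separable_space (top_of_set X)"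

text \<open>
  The domain of \<open>f s\<close> is \<open>[0, T s)\<close> with \<open>0 < T s \<le> \<infinity>\<close>. HOL functions are total, and the values
  of \<open>f s\<close> outside this interval are unconstrained; they do not affect \<open>Lambda\<close>
  or \<open>crit\<close> below, since \<open>\<delta> \<rightarrow> 0\<close>.
\<close>

definition is_scale :: "real set \<Rightarrow> (real \<Rightarrow> ereal) \<Rightarrow> (real \<Rightarrow> real \<Rightarrow> real) \<Rightarrow> bool" where
  "is_scale J T f \<longleftrightarrow>
     is_interval J \<and> J \<noteq> {} \<and>
     (\<forall>s\<in>J. 0 < T s \<and>
        continuous_on {r. 0 \<le> r \<and> ereal r < T s} (f s) \<and>
        mono_on {r. 0 \<le> r \<and> ereal r < T s} (f s) \<and>
        (\<forall>r. 0 \<le> r \<and> ereal r < T s \<longrightarrow> 0 \<le> f s r) \<and>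
        f s 0 = 0) \<and>
     (\<forall>s\<in>J. \<forall>t\<in>J. s < t \<longrightarrow>
        (\<forall>C\<ge>1. (\<lambda>r. f t (C * r)) \<in> o[at_right 0](\<lambda>r. f s r)))"

text \<open>
  Boundedness is required explicitly since \<^const>\<open>diameter\<close> is real-valued and
  meaningless on unbounded sets.
\<close>

definition closed_covers :: "'a::metric_space set \<Rightarrow> real \<Rightarrow> 'a set \<Rightarrow> (nat \<Rightarrow> 'a set) set" where
  "closed_covers X \<delta> A = {E. A \<subseteq> (\<Union>i. E i) \<and>
     (\<forall>i. closedin (top_of_set X) (E i) \<and> bounded (E i) \<and> diameter (E i) \<le> \<delta>)}"

definition Lambda_size :: "'a::metric_space set \<Rightarrow> (real \<Rightarrow> real) \<Rightarrow> real \<Rightarrow> 'a set \<Rightarrow> ennreal" where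
  "Lambda_size X f \<delta> A = (INF E\<in>closed_covers X \<delta> A. \<Sum>i. ennreal (f (diameter (E i))))"

definition Lambda :: "'a::metric_space set \<Rightarrow> (real \<Rightarrow> real) \<Rightarrow> 'a set \<Rightarrow> ennreal" where
  "Lambda X f A = Lim (at_right 0) (\<lambda>\<delta>. Lambda_size X f \<delta> A)"

text \<open>
  Suprema and infima of parameters are taken in the closure of \<open>J\<close> in \<open>[-\<infinity>, \<infinity>]\<close>, so that
  \<open>sup \<emptyset> = inf J\<close> and \<open>inf \<emptyset> = sup J\<close>.
\<close>

definition Sup_in :: "real set \<Rightarrow> ereal set \<Rightarrow> ereal" where
  "Sup_in J S = (if S = {} then Inf (ereal ` J) else Sup S)"

definition Inf_in :: "real set \<Rightarrow> ereal set \<Rightarrow> ereal" where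
  "Inf_in J S = (if S = {} then Sup (ereal ` J) else Inf S)"

text \<open>
  The definition uses the first of the four expressions for the critical parameter;
  \<open>crit_eqs\<close> below shows that it agrees with the other three.
\<close>

definition crit :: "'a::metric_space set \<Rightarrow> real set \<Rightarrow> (real \<Rightarrow> real \<Rightarrow> real) \<Rightarrow> 'a set \<Rightarrow> ereal" where
  "crit X J f A = Sup_in J (ereal ` {s\<in>J. Lambda X (f s) A = \<infinity>})"

definition sub_lipschitz_on :: "'a::metric_space set \<Rightarrow> ('a \<Rightarrow> 'b::metric_space) \<Rightarrow> bool" where
  "sub_lipschitz_on X g \<longleftrightarrow> (\<exists>D>0. \<forall>x\<in>X. \<forall>x'\<in>X. D * dist x x' \<le> dist (g x) (g x'))"

definition bi_lipschitz_on :: "'a::metric_space set \<Rightarrow> ('a \<Rightarrow> 'b::metric_space) \<Rightarrow> bool" where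
  "bi_lipschitz_on X g \<longleftrightarrow> (\<exists>L. L-lipschitz_on X g) \<and> sub_lipschitz_on X g"

lemma Lambda_size_antimono:
  assumes "\<delta> \<le> \<delta>'"
  shows "Lambda_size X f \<delta>' A \<le> Lambda_size X f \<delta> A"
  unfolding Lambda_size_def
  by (rule INF_superset_mono) (use assms in \<open>auto simp: closed_covers_def intro: order_trans\<close>)

lemma Lambda_size_tendsto:
  "((\<lambda>\<delta>. Lambda_size X f \<delta> A) \<longlongrightarrow> (SUP \<delta>\<in>{0<..}. Lambda_size X f \<delta> A)) (at_right 0)"
proof (rule increasing_tendsto)
  show "\<forall>\<^sub>F \<delta> in at_right 0. Lambda_size X f \<delta> A \<le> (SUP \<delta>\<in>{0<..}. Lambda_size X f \<delta> A)"
    by (auto simp: eventually_at_right_field intro!: exI[of _ 1] SUP_upper)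
  fix y assume "y < (SUP \<delta>\<in>{0<..}. Lambda_size X f \<delta> A)"
  then obtain d where d: "d > 0" "y < Lambda_size X f d A"
    by (auto simp: less_SUP_iff)
  then show "\<forall>\<^sub>F \<delta> in at_right 0. y < Lambda_size X f \<delta> A"
    unfolding eventually_at_right_field
    by (intro exI[of _ d]) (auto intro: less_le_trans[OF _ Lambda_size_antimono])
qed

lemma Lambda_eq_SUP: "Lambda X f A = (SUP \<delta>\<in>{0<..}. Lambda_size X f \<delta> A)"
  unfolding Lambda_def by (rule tendsto_Lim[OF _ Lambda_size_tendsto]) simp

lemma Lambda_zero_if_finite:
  assumes sc: "is_scale J T f" and st: "s \<in> J" "t \<in> J" "s < t"
    and fin: "Lambda X (f s) A < \<infinity>"
  shows "Lambda X (f t) A = 0"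
proof -
  have le: "Lambda X (f t) A \<le> ennreal \<epsilon> * Lambda X (f s) A" if \<epsilon>: "\<epsilon> > 0" for \<epsilon>
  proof -
    have "(\<lambda>r. f t (1 * r)) \<in> o[at_right 0](\<lambda>r. f s r)"
      using sc st unfolding is_scale_def by blast
    then have "\<forall>\<^sub>F r in at_right 0. norm (f t r) \<le> \<epsilon> * norm (f s r)"
      using \<epsilon> landau_o.smallD[of "\<lambda>r. f t r" "at_right 0" "\<lambda>r. f s r" \<epsilon>] by simp
    then obtain b where b: "b > 0" "\<And>r. 0 < r \<Longrightarrow> r < b \<Longrightarrow> \<bar>f t r\<bar> \<le> \<epsilon> * \<bar>f s r\<bar>"
      by (auto simp: eventually_at_right_field)
    have "0 < T s" using sc st unfolding is_scale_def by blast
    then obtain c where c: "c > 0" "ereal c < T s"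
      by (metis ereal_dense2 ereal_less(2))
    have zero: "f s 0 = 0" "f t 0 = 0" using sc st unfolding is_scale_def by blast+
    have nonneg: "0 \<le> f s r" if "0 \<le> r" "r \<le> c" for r
    proof -
      have "ereal r < T s" using that c le_less_trans[of "ereal r" "ereal c"] by simp
      then show ?thesis using sc st that unfolding is_scale_def by blast
    qed
    define m where "m = min (b/2) c"
    have m: "m > 0" "m < b" "m \<le> c" using b(1) c(1) unfolding m_def by auto
    have key: "ennreal (f t r) \<le> ennreal \<epsilon> * ennreal (f s r)" if "0 \<le> r" "r \<le> m" for r
    proof (cases "r = 0")
      case False
      then have "f t r \<le> \<epsilon> * f s r" using b(2)[of r] nonneg[of r] that m by auto
      then have "ennreal (f t r) \<le> ennreal (\<epsilon> * f s r)" by (rule ennreal_leI)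
      also have "\<dots> = ennreal \<epsilon> * ennreal (f s r)"
        using \<epsilon> nonneg[of r] that m by (intro ennreal_mult) auto
      finally show ?thesis .
    qed (simp add: zero)
    have small: "Lambda_size X (f t) \<delta> A \<le> ennreal \<epsilon> * Lambda X (f s) A" if "\<delta> \<le> m" "\<delta> > 0" for \<delta>
    proof -
      have inv: "ennreal (1 / \<epsilon>) * (ennreal \<epsilon> * x) = x" "ennreal \<epsilon> * (ennreal (1 / \<epsilon>) * x) = x" for x
        using \<epsilon> by (simp_all add: mult.assoc[symmetric] flip: ennreal_mult)
      have "ennreal (1 / \<epsilon>) * Lambda_size X (f t) \<delta> A \<le> Lambda_size X (f s) \<delta> A"
        unfolding Lambda_size_def[of X "f s"]
      proof (rule INF_greatest)
        fix E assume E: "E \<in> closed_covers X \<delta> A"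
        have "Lambda_size X (f t) \<delta> A \<le> (\<Sum>i. ennreal (f t (diameter (E i))))"
          unfolding Lambda_size_def using E by (rule INF_lower)
        also have "\<dots> \<le> (\<Sum>i. ennreal \<epsilon> * ennreal (f s (diameter (E i))))"
        proof (rule suminf_le)
          fix i
          have "0 \<le> diameter (E i)" "diameter (E i) \<le> \<delta>"
            using E by (auto simp: closed_covers_def intro: diameter_ge_0)
          then show "ennreal (f t (diameter (E i))) \<le> ennreal \<epsilon> * ennreal (f s (diameter (E i)))"
            using that by (intro key) auto
        qed auto
        also have "\<dots> = ennreal \<epsilon> * (\<Sum>i. ennreal (f s (diameter (E i))))" by simp
        finally have "ennreal (1 / \<epsilon>) * Lambda_size X (f t) \<delta> A
            \<le> ennreal (1 / \<epsilon>) * (ennreal \<epsilon> * (\<Sum>i. ennreal (f s (diameter (E i)))))"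
          by (rule mult_left_mono) simp
        then show "ennreal (1 / \<epsilon>) * Lambda_size X (f t) \<delta> A \<le> (\<Sum>i. ennreal (f s (diameter (E i))))"
          by (simp only: inv)
      qed
      then have "ennreal \<epsilon> * (ennreal (1 / \<epsilon>) * Lambda_size X (f t) \<delta> A)
          \<le> ennreal \<epsilon> * Lambda_size X (f s) \<delta> A"
        by (rule mult_left_mono) simp
      then have "Lambda_size X (f t) \<delta> A \<le> ennreal \<epsilon> * Lambda_size X (f s) \<delta> A"
        by (simp only: inv)
      also have "\<dots> \<le> ennreal \<epsilon> * Lambda X (f s) A"
        unfolding Lambda_eq_SUP using \<open>\<delta> > 0\<close> by (intro mult_left_mono SUP_upper) auto
      finally show ?thesis .
    qed
    show ?thesis
      unfolding Lambda_eq_SUP[of X "f t"]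
    proof (rule SUP_least)
      fix \<delta> :: real assume "\<delta> \<in> {0<..}"
      then have "Lambda_size X (f t) (min \<delta> m) A \<le> ennreal \<epsilon> * Lambda X (f s) A"
        using m by (intro small) auto
      then show "Lambda_size X (f t) \<delta> A \<le> ennreal \<epsilon> * Lambda X (f s) A"
        using Lambda_size_antimono[of "min \<delta> m" \<delta> X "f t" A] by (auto intro: order_trans)
    qed
  qed
  obtain L where L: "L \<ge> 0" "Lambda X (f s) A = ennreal L"
    using fin by (cases "Lambda X (f s) A") auto
  have "Lambda X (f t) A \<le> 0 + ennreal e" if "e > 0" for e
  proof -
    have "Lambda X (f t) A \<le> ennreal (e / (L + 1)) * ennreal L"
      using le[of "e / (L + 1)"] L that by simp
    also have "\<dots> = ennreal (e / (L + 1) * L)" using L that by (intro ennreal_mult[symmetric]) auto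
    also have "\<dots> \<le> ennreal e" using L that by (intro ennreal_leI) (simp add: field_simps)
    finally show ?thesis by simp
  qed
  then have "Lambda X (f t) A \<le> 0" by (rule ennreal_le_epsilon)
  then show ?thesis by simp
qed

lemma crit_eqs:
  assumes sc: "is_scale J T f"
  shows "crit X J f A = Sup_in J (ereal ` {s\<in>J. Lambda X (f s) A > 0})"
    and "crit X J f A = Inf_in J (ereal ` {s\<in>J. Lambda X (f s) A = 0})"
    and "crit X J f A = Inf_in J (ereal ` {s\<in>J. Lambda X (f s) A < \<infinity>})"
proof -
  let ?L = "\<lambda>s. Lambda X (f s) A"
  let ?S1 = "Sup_in J (ereal ` {s\<in>J. ?L s = \<infinity>})" and ?S2 = "Sup_in J (ereal ` {s\<in>J. ?L s > 0})"
  let ?I1 = "Inf_in J (ereal ` {s\<in>J. ?L s < \<infinity>})" and ?I2 = "Inf_in J (ereal ` {s\<in>J. ?L s = 0})"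
  have J: "is_interval J" "J \<noteq> {}" using sc unfolding is_scale_def by auto
  obtain j where j: "j \<in> J" using J by blast
  have InfSup: "Inf (ereal ` J) \<le> Sup S" if "S \<subseteq> ereal ` J" "S \<noteq> {}" for S
    using that by (meson Inf_lower2 Sup_upper subset_iff ex_in_conv)
  have InfSup': "Inf S \<le> Sup (ereal ` J)" if "S \<subseteq> ereal ` J" "S \<noteq> {}" for S
    using that by (meson Inf_lower2 Sup_upper subset_iff ex_in_conv)
  have Sup_in_mono: "Sup_in J S \<le> Sup_in J S'" if "S \<subseteq> S'" "S' \<subseteq> ereal ` J" for S S'
    using that InfSup[of S'] by (auto simp: Sup_in_def Sup_subset_mono)
  have Inf_in_anti: "Inf_in J S' \<le> Inf_in J S" if "S \<subseteq> S'" "S' \<subseteq> ereal ` J" for S S'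
    using that InfSup'[of S'] by (auto simp: Inf_in_def Inf_superset_mono)
  have a: "?S1 \<le> ?S2" by (rule Sup_in_mono) auto
  have b: "?I1 \<le> ?I2" by (rule Inf_in_anti) auto
  have c: "?S2 \<le> ?I1"
  proof -
    have sep: "s \<le> t" if "s \<in> J" "t \<in> J" "?L s > 0" "?L t < \<infinity>" for s t
      using Lambda_zero_if_finite[OF sc, of t s X A] that by force
    have up: "Inf (ereal ` J) \<le> ereal s" "ereal s \<le> Sup (ereal ` J)" if "s \<in> J" for s
      using that by (auto intro: INF_lower SUP_upper)
    have "Inf (ereal ` J) \<le> Sup (ereal ` J)" using up[OF j] by (rule order_trans)
    then show ?thesis unfolding Sup_in_def Inf_in_def
      by (auto intro!: Sup_least Inf_greatest sep up)
  qed
  have d: "?I2 \<le> ?S1"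
  proof (rule ccontr)
    assume "\<not> ?I2 \<le> ?S1"
    then have lt: "?S1 < ?I2" by simp
    have lo: "Inf (ereal ` J) \<le> ?S1" using InfSup[of "ereal ` {s\<in>J. ?L s = \<infinity>}"] by (auto simp: Sup_in_def)
    have hi: "?I2 \<le> Sup (ereal ` J)" using InfSup'[of "ereal ` {s\<in>J. ?L s = 0}"] by (auto simp: Inf_in_def)
    have inJ: "x \<in> J" if "?S1 < ereal x" "ereal x < ?I2" for x
    proof -
      have "Inf (ereal ` J) < ereal x" "ereal x < Sup (ereal ` J)"
        using that lo hi by (auto intro: le_less_trans less_le_trans)
      then obtain p q where "p \<in> J" "q \<in> J" "p < x" "x < q"
        by (auto simp: Inf_less_iff less_Sup_iff)
      then show ?thesis using J(1) unfolding is_interval_1 by (meson less_imp_le)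
    qed
    obtain u where u: "?S1 < ereal u" "ereal u < ?I2" using lt ereal_dense2 by blast
    obtain v where v: "ereal u < ereal v" "ereal v < ?I2" using u(2) ereal_dense2 by blast
    have uJ: "u \<in> J" using inJ u by blast
    have vJ: "v \<in> J" using inJ less_trans[OF u(1) v(1)] v(2) by blast
    have "?L u \<noteq> \<infinity>"
    proof
      assume "?L u = \<infinity>"
      then have "ereal u \<in> ereal ` {s\<in>J. ?L s = \<infinity>}" using uJ by blast
      then have "ereal u \<le> ?S1" unfolding Sup_in_def by (auto intro: Sup_upper)
      then show False using u(1) by simp
    qed
    then have "?L v = 0" using Lambda_zero_if_finite[OF sc uJ vJ] v(1) by (simp add: less_top)
    then have "ereal v \<in> ereal ` {s\<in>J. ?L s = 0}" using vJ by blast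
    then have "?I2 \<le> ereal v" unfolding Inf_in_def by (auto intro: Inf_lower)
    then show False using v(2) by simp
  qed
  show "crit X J f A = ?S2" "crit X J f A = ?I2" "crit X J f A = ?I1"
    unfolding crit_def using a b c d by order+
qed

end

theory Submission
  imports Defs
begin

text \<open>
  The four properties rest on three comparisons between the measures \<^const>\<open>Lambda\<close>, each passed
  on to the critical parameters.

  Monotonicity holds for every gauge function, because a cover of \<open>B\<close> is a cover of \<open>A\<close>.

  For a countable union, a countable union of null sets is null (covers with total weights
  \<open>\<epsilon>/2, \<epsilon>/4, \<dots>\<close> are merged into one). Hence if the union has positive measure for \<open>f s\<close>, so has
  some \<open>A i\<close>, and then \<open>s \<le> crit (A i)\<close> once the critical parameter is read as a supremum over
  positive measure rather than infinite measure.

  For a map \<open>g\<close> with \<open>D * dist x x' \<le> dist (g x) (g x')\<close>, a cover of the target pulls back to a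
  cover of the source with diameters enlarged by a factor at most \<open>C = max 1 (1/D)\<close>. A gauge need
  not control \<open>f s (C * r)\<close> by \<open>f s r\<close>, so this says nothing about a single parameter; but
  the separation property bounds \<open>f t (C * r)\<close> by \<open>f s r\<close> for small \<open>r\<close> whenever \<open>s < t\<close>.
  The measure of the source for \<open>f t\<close> is therefore at most that of the target for \<open>f s\<close>, so no
  \<open>t\<close> with infinite measure in the source lies above an \<open>s\<close> with finite measure in the target.
  Reading one critical parameter as a supremum and the other as an infimum gives the inequality.
  Finally, the inverse of a Lipschitz map is sub-Lipschitz, which yields the invariance.
\<close>

section \<open>Monotonicity\<close>

lemma Lambda_mono:
  assumes "A \<subseteq> B"
  shows "Lambda X f A \<le> Lambda X f B"
proof -
  have "Lambda_size X f \<delta> A \<le> Lambda_size X f \<delta> B" for \<delta>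
    unfolding Lambda_size_def
    by (rule INF_superset_mono) (use assms in \<open>auto simp: closed_covers_def\<close>)
  then show ?thesis
    unfolding Lambda_eq_SUP by (intro SUP_mono) auto
qed

text \<open>
  The bound \<open>S' \<subseteq> ereal ` J\<close> is needed for \<open>S = {}\<close>, where the convention \<open>sup \<emptyset> = inf J\<close> must
  stay below the supremum of \<open>S'\<close>.
\<close>

lemma Sup_in_mono:
  assumes "S \<subseteq> S'" "S' \<subseteq> ereal ` J"
  shows "Sup_in J S \<le> Sup_in J S'"
proof (cases "S = {}")
  case True
  then show ?thesis
    using assms(2) by (auto simp: Sup_in_def intro: Inf_le_Sup order_trans[OF Inf_superset_mono])
next
  case False
  then show ?thesis
    using assms(1) by (auto simp: Sup_in_def intro: Sup_subset_mono)
qed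

lemma Inf_le_crit: "Inf (ereal ` J) \<le> crit X J f A"
proof -
  have "Sup_in J {} \<le> crit X J f A"
    unfolding crit_def by (rule Sup_in_mono) auto
  then show ?thesis
    by (simp add: Sup_in_def)
qed

lemma crit_mono:
  assumes "A \<subseteq> B"
  shows "crit X J f A \<le> crit X J f B"
proof -
  have "Lambda X (f s) B = \<infinity>" if "Lambda X (f s) A = \<infinity>" for s
    using Lambda_mono[OF assms, of X "f s"] that by (simp add: top_unique)
  then show ?thesis
    unfolding crit_def by (intro Sup_in_mono) auto
qed

section \<open>Countable unions\<close>

lemma Lambda_null_iff:
  "Lambda X f A = 0 \<longleftrightarrow>
    (\<forall>\<delta>>0. \<forall>e>0. \<exists>E\<in>closed_covers X \<delta> A. (\<Sum>i. ennreal (f (diameter (E i)))) < e)"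
proof -
  have "Lambda X f A = 0 \<longleftrightarrow> (\<forall>\<delta>>0. Lambda_size X f \<delta> A \<le> 0)"
    unfolding Lambda_eq_SUP le_zero_eq[symmetric] SUP_le_iff by auto
  also have "\<dots> \<longleftrightarrow> (\<forall>\<delta>>0. \<forall>e>0. Lambda_size X f \<delta> A < e)"
    by (auto simp: zero_less_iff_neq_zero)
  finally show ?thesis
    by (simp add: Lambda_size_def INF_less_iff)
qed

text \<open>
  For a fixed \<open>\<delta>\<close>, each \<open>A n\<close> has a cover of total weight less than \<open>r / 2 ^ Suc n\<close>. Listing all
  these covering sets along a pairing of the naturals gives a cover of the union, with the same
  bound \<open>\<delta>\<close> on the diameters and total weight at most \<open>r\<close>.
\<close>

lemma Lambda_null_UN_nat:
  fixes A :: "nat \<Rightarrow> 'a::metric_space set"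
  assumes null: "\<And>n. Lambda X f (A n) = 0"
  shows "Lambda X f (\<Union>n. A n) = 0"
  unfolding Lambda_null_iff
proof (intro allI impI)
  fix \<delta> :: real and e :: ennreal
  assume "\<delta> > 0" "e > 0"
  obtain r where r: "r > 0" "ennreal r < e"
    using \<open>e > 0\<close> by (metis dense ennreal_cases ennreal_less_zero_iff less_top_ennreal top.not_eq_extremum order_less_trans)
  define w where "w n = r * (1/2) ^ Suc n" for n
  have "\<exists>E\<in>closed_covers X \<delta> (A n). (\<Sum>i. ennreal (f (diameter (E i)))) < ennreal (w n)" for n
    using null[of n] \<open>\<delta> > 0\<close> r(1) unfolding Lambda_null_iff w_def by simp
  then obtain E where E: "E n \<in> closed_covers X \<delta> (A n)"
    "(\<Sum>i. ennreal (f (diameter (E n i)))) < ennreal (w n)" for n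
    by metis
  define G where "G k = (case prod_decode k of (n, i) \<Rightarrow> E n i)" for k
  have G_enc: "G (prod_encode (n, i)) = E n i" for n i
    by (simp add: G_def)
  have "G \<in> closed_covers X \<delta> (\<Union>n. A n)"
  proof -
    have "A n \<subseteq> (\<Union>k. G k)" for n
    proof
      fix x assume "x \<in> A n"
      then obtain i where "x \<in> E n i"
        using E(1)[of n] by (auto simp: closed_covers_def)
      then show "x \<in> (\<Union>k. G k)"
        using G_enc by blast
    qed
    then show ?thesis
      using E(1) by (auto simp: closed_covers_def G_def split: prod.splits)
  qed
  moreover have "(\<Sum>k. ennreal (f (diameter (G k)))) < e"
  proof -
    have "(\<Sum>k. ennreal (f (diameter (G k)))) = (\<Sum>n. \<Sum>i. ennreal (f (diameter (E n i))))"
      using suminf_ennreal_2dimen[of "\<lambda>n. \<Sum>i. ennreal (f (diameter (E n i)))"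
          "\<lambda>(n, i). ennreal (f (diameter (E n i)))"]
      by (simp add: G_def case_prod_beta)
    also have "\<dots> \<le> (\<Sum>n. ennreal (w n))"
      by (rule suminf_le) (auto intro: less_imp_le E(2))
    also have "\<dots> = ennreal r"
    proof (rule suminf_ennreal_eq)
      show "w sums r"
        unfolding w_def using sums_mult[OF power_half_series, of r] by simp
    qed (use r(1) in \<open>simp add: w_def\<close>)
    finally show ?thesis
      using r(2) by simp
  qed
  ultimately show "\<exists>E\<in>closed_covers X \<delta> (\<Union>n. A n). (\<Sum>i. ennreal (f (diameter (E i)))) < e"
    by blast
qed

lemma Lambda_null_UN:
  assumes "countable I" "\<And>i. i \<in> I \<Longrightarrow> Lambda X f (A i) = 0" "I \<noteq> {}"
  shows "Lambda X f (\<Union>i\<in>I. A i) = 0"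
proof -
  have "(\<Union>i\<in>I. A i) = (\<Union>n. A (from_nat_into I n))"
    using range_from_nat_into[OF assms(3,1)] by (metis image_image)
  then show ?thesis
    using assms Lambda_null_UN_nat[of X f "\<lambda>n. A (from_nat_into I n)"] by (simp add: from_nat_into)
qed

text \<open>
  Null unions alone suffice because \<open>crit\<close> is also the supremum of the parameters with positive
  measure: infinite measure of a union need not come from infinite measure of one part,
  but positive measure does come from positive measure of one part.
\<close>

lemma crit_UN:
  assumes sc: "is_scale J T f" and I: "countable I"
  shows "crit X J f (\<Union>i\<in>I. A i) = Sup_in J ((\<lambda>i. crit X J f (A i)) ` I)"
proof (cases "I = {}")
  case True
  have "Lambda X (f s) {} = 0" if "s \<in> J" for s
  proof -
    have "f s 0 = 0"
      using sc that unfolding is_scale_def by blast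
    then show ?thesis
      unfolding Lambda_null_iff by (intro allI impI bexI[of _ "\<lambda>_. {}"]) (auto simp: closed_covers_def)
  qed
  then have "{s \<in> J. Lambda X (f s) {} = \<infinity>} = {}"
    by auto
  then show ?thesis
    using True by (simp add: crit_def Sup_in_def)
next
  case False
  let ?U = "\<Union>i\<in>I. A i"
  have "crit X J f ?U = (SUP i\<in>I. crit X J f (A i))"
  proof (rule antisym)
    show "(SUP i\<in>I. crit X J f (A i)) \<le> crit X J f ?U"
      by (intro SUP_least crit_mono) auto
    have "ereal s \<le> (SUP i\<in>I. crit X J f (A i))" if s: "s \<in> J" "Lambda X (f s) ?U > 0" for s
    proof -
      obtain i where i: "i \<in> I" "Lambda X (f s) (A i) > 0"
        using Lambda_null_UN[OF I, of X "f s" A] False s(2) by fastforce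
      then have "ereal s \<le> crit X J f (A i)"
        unfolding crit_eqs(1)[OF sc] Sup_in_def using s(1) by (auto intro: Sup_upper)
      then show ?thesis
        using i(1) by (rule SUP_upper2[rotated])
    qed
    moreover have "Inf (ereal ` J) \<le> (SUP i\<in>I. crit X J f (A i))"
      using False by (auto intro: SUP_upper2 Inf_le_crit)
    ultimately show "crit X J f ?U \<le> (SUP i\<in>I. crit X J f (A i))"
      unfolding crit_eqs(1)[OF sc, of X ?U] Sup_in_def by (auto intro!: Sup_least)
  qed
  then show ?thesis
    using False by (simp add: Sup_in_def)
qed

section \<open>Sub-Lipschitz maps\<close>

text \<open>
  The separation property compares \<open>f t (C * r)\<close> with \<open>f s r\<close>; monotonicity of \<open>f t\<close> extends the
  comparison to any \<open>\<rho> \<le> C * r\<close>, as required for pulled-back sets, whose diameter is only bounded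
  above. It holds at \<open>r = 0\<close> too, outside the reach of the limit \<open>r \<rightarrow> 0\<close>, because both gauges vanish
  there; sets of diameter \<open>0\<close> do occur in covers.
\<close>

lemma scale_dominates_dilate:
  assumes sc: "is_scale J T f" and st: "s \<in> J" "t \<in> J" "s < t" and C: "C \<ge> 1"
  obtains m where "m > 0"
    "\<And>r \<rho>. 0 \<le> \<rho> \<Longrightarrow> \<rho> \<le> C * r \<Longrightarrow> r \<le> m \<Longrightarrow> ennreal (f t \<rho>) \<le> ennreal (f s r)"
proof -
  have "(\<lambda>r. f t (C * r)) \<in> o[at_right 0](\<lambda>r. f s r)"
    using sc st C unfolding is_scale_def by blast
  then have "\<forall>\<^sub>F r in at_right 0. norm (f t (C * r)) \<le> 1 * norm (f s r)"
    by (rule landau_o.smallD) simp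
  then obtain b where b: "b > 0" "\<And>r. 0 < r \<Longrightarrow> r < b \<Longrightarrow> \<bar>f t (C * r)\<bar> \<le> \<bar>f s r\<bar>"
    by (auto simp: eventually_at_right_field)
  have "0 < T s" "0 < T t" and zero: "f s 0 = 0" "f t 0 = 0"
    using sc st unfolding is_scale_def by blast+
  then obtain c d where c: "c > 0" "ereal c < T s" and d: "d > 0" "ereal d < T t"
    using ereal_dense2[of 0 "T s"] ereal_dense2[of 0 "T t"] by auto
  \<comment> \<open>Small enough that the separation estimate applies to \<open>r\<close>, and that \<open>r\<close> and \<open>C * r\<close> lie in the
    domains of \<open>f s\<close> and \<open>f t\<close>.\<close>
  define m where "m = min (b/2) (min c (d / C))"
  have m: "m > 0" "m < b" "m \<le> c" "C * m \<le> d"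
  proof -
    show "m > 0" "m < b" "m \<le> c"
      using b(1) c(1) d(1) C unfolding m_def by auto
    have "C * m \<le> C * (d / C)"
      using C unfolding m_def by (intro mult_left_mono) auto
    then show "C * m \<le> d"
      using C by simp
  qed
  show thesis
  proof
    fix r \<rho> assume \<rho>: "0 \<le> \<rho>" "\<rho> \<le> C * r" and r: "r \<le> m"
    have r0: "0 \<le> r"
      using zero_le_mult_iff[of C r] \<rho> C by linarith
    show "ennreal (f t \<rho>) \<le> ennreal (f s r)"
    proof (cases "r = 0")
      case True
      then show ?thesis
        using \<rho> zero by simp
    next
      case False
      have "C * r \<le> d" "\<rho> \<le> d"
        using mult_left_mono[OF r, of C] C m(4) \<rho>(2) by linarith+
      then have "ereal (C * r) < T t" "ereal \<rho> < T t"
        using le_less_trans[OF _ d(2)] by simp_all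
      moreover have "mono_on {r. 0 \<le> r \<and> ereal r < T t} (f t)"
        using sc st unfolding is_scale_def by blast
      ultimately have "f t \<rho> \<le> f t (C * r)"
        using \<rho> by (auto elim!: mono_onD)
      also have "\<dots> \<le> \<bar>f s r\<bar>"
        using b(2)[of r] False r0 r m(2) by auto
      also have "\<bar>f s r\<bar> = f s r"
      proof -
        have "ereal r < T s"
          using le_less_trans[OF _ c(2), of "ereal r"] r m(3) by simp
        then have "0 \<le> f s r"
          using sc st r0 unfolding is_scale_def by blast
        then show ?thesis
          by simp
      qed
      finally show ?thesis
        by (rule ennreal_leI)
    qed
  qed (fact m(1))
qed

lemma bounded_diameter_closure_le:
  fixes S :: "'a::metric_space set"
  assumes "\<And>x y. x \<in> S \<Longrightarrow> y \<in> S \<Longrightarrow> dist x y \<le> d" "0 \<le> d"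
  shows "bounded (closure S)" "diameter (closure S) \<le> d"
proof -
  have "bounded S"
    using assms(1) unfolding bounded_two_points by blast
  moreover have "diameter S \<le> d"
    using assms by (auto simp: diameter_def intro!: cSUP_least)
  ultimately show "bounded (closure S)" "diameter (closure S) \<le> d"
    by (auto simp: diameter_closure)
qed

text \<open>
  Given a cover \<open>F\<close> of \<open>B\<close>, the preimages of the \<open>F i\<close> cover \<open>A\<close> and have diameter at most
  \<open>C * diameter (F i)\<close>. A sub-Lipschitz map need not be continuous, so these preimages need not be
  closed; passing to closures repairs this without changing diameters. The loss of the factor \<open>C\<close>
  is absorbed by moving from \<open>s\<close> to a larger parameter \<open>t\<close>.
\<close>

lemma Lambda_le_Lambda_sub_lipschitz:
  fixes g :: "'a::metric_space \<Rightarrow> 'b::metric_space"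
  assumes sc: "is_scale J T f" and st: "s \<in> J" "t \<in> J" "s < t"
    and g: "g ` A \<subseteq> B" "sub_lipschitz_on A g" and AX: "A \<subseteq> X"
  shows "Lambda X (f t) A \<le> Lambda Y (f s) B"
proof -
  obtain D where D: "D > 0" "\<And>x x'. x \<in> A \<Longrightarrow> x' \<in> A \<Longrightarrow> D * dist x x' \<le> dist (g x) (g x')"
    using g(2) unfolding sub_lipschitz_on_def by blast
  \<comment> \<open>The separation property is available for factors \<open>C \<ge> 1\<close> only, hence the maximum.\<close>
  define C where "C = max 1 (1 / D)"
  have C: "C \<ge> 1" "\<And>x x'. x \<in> A \<Longrightarrow> x' \<in> A \<Longrightarrow> dist x x' \<le> C * dist (g x) (g x')"
  proof -
    fix x x' assume "x \<in> A" "x' \<in> A"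
    then have "dist x x' \<le> 1 / D * dist (g x) (g x')"
      using D by (simp add: field_simps)
    also have "\<dots> \<le> C * dist (g x) (g x')"
      unfolding C_def by (intro mult_right_mono) auto
    finally show "dist x x' \<le> C * dist (g x) (g x')" .
  qed (simp add: C_def)
  obtain m where m: "m > 0"
    "\<And>r \<rho>. 0 \<le> \<rho> \<Longrightarrow> \<rho> \<le> C * r \<Longrightarrow> r \<le> m \<Longrightarrow> ennreal (f t \<rho>) \<le> ennreal (f s r)"
    using scale_dominates_dilate[OF sc st C(1)] by blast
  have "Lambda_size X (f t) \<delta> A \<le> Lambda Y (f s) B" if \<delta>: "\<delta> > 0" for \<delta>
  proof -
    define \<delta>' where "\<delta>' = min m (\<delta> / C)"
    have \<delta>': "\<delta>' > 0" "\<delta>' \<le> m" "C * \<delta>' \<le> \<delta>"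
      using m(1) \<delta> C(1) unfolding \<delta>'_def by (auto simp: field_simps min_def)
    have "Lambda_size X (f t) \<delta> A \<le> Lambda_size Y (f s) \<delta>' B"
      unfolding Lambda_size_def[of Y]
    proof (rule INF_greatest)
      fix F assume F: "F \<in> closed_covers Y \<delta>' B"
      have Fb: "bounded (F i)" "diameter (F i) \<le> \<delta>'" for i
        using F by (auto simp: closed_covers_def)
      define P where "P i = {x \<in> A. g x \<in> F i}" for i
      define E where "E i = X \<inter> closure (P i)" for i
      have P_dist: "dist x x' \<le> C * diameter (F i)" if "x \<in> P i" "x' \<in> P i" for i x x'
      proof -
        have "dist x x' \<le> C * dist (g x) (g x')"
          using that by (intro C(2)) (auto simp: P_def)
        also have "\<dots> \<le> C * diameter (F i)"
          using that C(1) by (intro mult_left_mono diameter_bounded_bound Fb) (auto simp: P_def)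
        finally show ?thesis .
      qed
      have cl: "bounded (closure (P i))" "diameter (closure (P i)) \<le> C * diameter (F i)" for i
        using bounded_diameter_closure_le[of "P i" "C * diameter (F i)"] P_dist
          C(1) diameter_ge_0[OF Fb(1)] by simp_all
      have E_diam: "diameter (E i) \<le> C * diameter (F i)" for i
        unfolding E_def by (rule order_trans[OF diameter_subset[OF Int_lower2 cl(1)] cl(2)])
      have E_bdd: "bounded (E i)" for i
        unfolding E_def using cl(1) by (rule bounded_subset) auto
      have "A \<subseteq> (\<Union>i. E i)"
      proof
        fix x assume x: "x \<in> A"
        then obtain i where "g x \<in> F i"
          using F g(1) by (force simp: closed_covers_def)
        then have "x \<in> P i"
          using x by (simp add: P_def)
        then show "x \<in> (\<Union>i. E i)"
          using x AX closure_subset unfolding E_def by blast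
      qed
      moreover have "diameter (E i) \<le> \<delta>" for i
      proof -
        have "C * diameter (F i) \<le> C * \<delta>'"
          using C(1) Fb(2) by (intro mult_left_mono) auto
        then show ?thesis
          using E_diam[of i] \<delta>'(3) by linarith
      qed
      ultimately have "E \<in> closed_covers X \<delta> A"
        using E_bdd by (auto simp: closed_covers_def E_def closedin_closed_Int)
      then have "Lambda_size X (f t) \<delta> A \<le> (\<Sum>i. ennreal (f t (diameter (E i))))"
        unfolding Lambda_size_def by (rule INF_lower)
      also have "\<dots> \<le> (\<Sum>i. ennreal (f s (diameter (F i))))"
        using E_bdd E_diam Fb(2) \<delta>'(2)
        by (intro suminf_le m(2)) (auto intro: diameter_ge_0 order_trans)
      finally show "Lambda_size X (f t) \<delta> A \<le> (\<Sum>i. ennreal (f s (diameter (F i))))" .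
    qed
    also have "\<dots> \<le> Lambda Y (f s) B"
      unfolding Lambda_eq_SUP using \<delta>'(1) by (intro SUP_upper) auto
    finally show ?thesis .
  qed
  then show ?thesis
    unfolding Lambda_eq_SUP[of X] by (intro SUP_least) auto
qed

text \<open>
  It is enough to show \<open>t \<le> s\<close> whenever \<open>A\<close> has infinite measure for \<open>f t\<close> and \<open>B\<close> has finite
  measure for \<open>f s\<close>: the left-hand side is the supremum of such \<open>t\<close>, the right-hand side the infimum
  of such \<open>s\<close>.
\<close>

lemma crit_le_crit_sub_lipschitz:
  fixes g :: "'a::metric_space \<Rightarrow> 'b::metric_space"
  assumes sc: "is_scale J T f"
    and g: "g ` A \<subseteq> B" "sub_lipschitz_on A g" and AX: "A \<subseteq> X"
  shows "crit X J f A \<le> crit Y J f B"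
proof -
  have sep: "ereal t \<le> ereal s"
    if "t \<in> J" "Lambda X (f t) A = \<infinity>" "s \<in> J" "Lambda Y (f s) B < \<infinity>" for s t
    using Lambda_le_Lambda_sub_lipschitz[OF sc, of s t g A B X Y] g AX that
    by (metis ereal_less_eq(3) infinity_ennreal_def leD not_le_imp_less)
  have up: "ereal t \<le> Sup (ereal ` J)" if "t \<in> J" for t
    using that by (auto intro: SUP_upper)
  have "ereal t \<le> crit Y J f B" if "t \<in> J" "Lambda X (f t) A = \<infinity>" for t
    unfolding crit_eqs(3)[OF sc, of Y] Inf_in_def using that by (auto intro!: Inf_greatest sep up)
  then show ?thesis
    using Inf_le_crit[of J Y f B] unfolding crit_def[of X] Sup_in_def
    by (auto intro!: Sup_least)
qed

text \<open>
  Any choice of preimages works, since the Lipschitz estimate bounds \<open>dist y y'\<close> by the distance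
  of whichever preimages are taken. The constant is \<open>1 / (L + 1)\<close> rather than \<open>1 / L\<close> because \<open>L\<close>
  may be \<open>0\<close>.
\<close>

lemma sub_lipschitz_on_inv_into:
  assumes "L-lipschitz_on X g"
  shows "sub_lipschitz_on (g ` X) (inv_into X g)"
proof -
  have L: "L \<ge> 0"
    using assms by (rule lipschitz_on_nonneg)
  have "1 / (L + 1) * dist y y' \<le> dist (inv_into X g y) (inv_into X g y')"
    if "y \<in> g ` X" "y' \<in> g ` X" for y y'
  proof -
    let ?x = "inv_into X g y" and ?x' = "inv_into X g y'"
    have "dist y y' = dist (g ?x) (g ?x')"
      using that by (simp add: f_inv_into_f)
    also have "\<dots> \<le> L * dist ?x ?x'"
      using that by (intro lipschitz_onD[OF assms] inv_into_into)
    also have "\<dots> \<le> (L + 1) * dist ?x ?x'"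
      by (intro mult_right_mono) auto
    finally show ?thesis
      using L by (simp add: field_simps)
  qed
  moreover have "1 / (L + 1) > 0"
    using L by simp
  ultimately show ?thesis
    unfolding sub_lipschitz_on_def by blast
qed

section \<open>The four properties of the critical parameter\<close>

theorem proposition2p4:
  fixes X :: "'a::metric_space set"
    and J :: "real set" and T :: "real \<Rightarrow> ereal" and f :: "real \<Rightarrow> real \<Rightarrow> real"
  assumes "polish_metric_space X"
    and "is_scale J T f"
  shows "(\<forall>A B. A \<subseteq> B \<and> B \<subseteq> X \<longrightarrow> crit X J f A \<le> crit X J f B) \<and>
    (\<forall>(I :: 'i set) A. countable I \<and> (\<forall>i\<in>I. A i \<subseteq> X) \<longrightarrow>
       crit X J f (\<Union>i\<in>I. A i) = Sup_in J ((\<lambda>i. crit X J f (A i)) ` I)) \<and>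
    (\<forall>Y :: 'b::metric_space set. polish_metric_space Y \<and>
       (\<exists>g. g \<in> X \<rightarrow> Y \<and> sub_lipschitz_on X g) \<longrightarrow>
       crit X J f X \<le> crit Y J f Y) \<and>
    (\<forall>Y :: 'b set. polish_metric_space Y \<and>
       (\<exists>g. g ` X = Y \<and> bi_lipschitz_on X g) \<longrightarrow>
       crit X J f X = crit Y J f Y)"
proof (intro conjI allI impI)
  fix A B :: "'a set"
  assume "A \<subseteq> B \<and> B \<subseteq> X"
  then show "crit X J f A \<le> crit X J f B"
    by (blast intro: crit_mono)
next
  fix I :: "'i set" and A :: "'i \<Rightarrow> 'a set"
  assume "countable I \<and> (\<forall>i\<in>I. A i \<subseteq> X)"
  then show "crit X J f (\<Union>i\<in>I. A i) = Sup_in J ((\<lambda>i. crit X J f (A i)) ` I)"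
    by (blast intro: crit_UN[OF assms(2)])
next
  fix Y :: "'b set"
  assume "polish_metric_space Y \<and> (\<exists>g. g \<in> X \<rightarrow> Y \<and> sub_lipschitz_on X g)"
  then obtain g where "g ` X \<subseteq> Y" "sub_lipschitz_on X g"
    by blast
  then show "crit X J f X \<le> crit Y J f Y"
    by (rule crit_le_crit_sub_lipschitz[OF assms(2)]) simp
next
  fix Y :: "'b set"
  assume "polish_metric_space Y \<and> (\<exists>g. g ` X = Y \<and> bi_lipschitz_on X g)"
  then obtain g L where g: "g ` X = Y" "L-lipschitz_on X g" "sub_lipschitz_on X g"
    unfolding bi_lipschitz_on_def by blast
  show "crit X J f X = crit Y J f Y"
  proof (rule antisym)
    show "crit X J f X \<le> crit Y J f Y"
      using g by (intro crit_le_crit_sub_lipschitz[OF assms(2), of g]) auto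
    have "inv_into X g ` Y \<subseteq> X"
      using g(1) by (auto intro: inv_into_into)
    then show "crit Y J f Y \<le> crit X J f X"
      using sub_lipschitz_on_inv_into[OF g(2)] g(1)
      by (intro crit_le_crit_sub_lipschitz[OF assms(2), of "inv_into X g"]) auto
  qed
qed

end
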